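(* Let $(X,* )$ be a finite quandle. There is a non-discrete $T_0$-topology on $X$ making all right multiplications of $X$ continuous if and only if $X$ has more than one orbit.
   Context: A quandle is a set $X$ with a binary operation $*$ such that: (1) $x*x=x$ for all $x$; (2) for all $y,z\in X$ there is a unique $x\in X$ with $x*y=z$; (3) $(x*y)*z=(x*z)*(y*z)$ for all $x,y,z$. The right multiplications $R_y:X\to X$, $R_y(x)=x*y$, are automorphisms of $X$; the subgroup of the automorphism group they generate is the inner automorphism group $\mathrm{Inn}(X)$, and the orbits of $X$ are the orbits of its action on $X$. *)

theory Defs
  imports
    "HOL-Analysis.Abstract_Topological_Spaces"
    "HOL-Algebra.Group_Action"
    "HOL-Algebra.Generated_Groups"
begin

locale quandle =
  fixes X :: "'a set" and op :: "'a \<Rightarrow> 'a \<Rightarrow> 'a"  (infixl \<open>\<triangleright>\<close> 70)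
  assumes closed: "\<lbrakk>x \<in> X; y \<in> X\<rbrakk> \<Longrightarrow> x \<triangleright> y \<in> X"
    and idem: "x \<in> X \<Longrightarrow> x \<triangleright> x = x"
    and right_div: "\<lbrakk>y \<in> X; z \<in> X\<rbrakk> \<Longrightarrow> \<exists>!x. x \<in> X \<and> x \<triangleright> y = z"
    and self_distrib: "\<lbrakk>x \<in> X; y \<in> X; z \<in> X\<rbrakk> \<Longrightarrow> (x \<triangleright> y) \<triangleright> z = (x \<triangleright> z) \<triangleright> (y \<triangleright> z)"

text \<open>Self-maps of \<open>X\<close> are taken to be undefined outside \<open>X\<close>, so that they are
  elements of the library's permutation group \<^const>\<open>BijGroup\<close>.\<close>

definition right_mult :: "'a set \<Rightarrow> ('a \<Rightarrow> 'a \<Rightarrow> 'a) \<Rightarrow> 'a \<Rightarrow> 'a \<Rightarrow> 'a" where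
  "right_mult X op y = (\<lambda>x\<in>X. op x y)"

definition quandle_auts :: "'a set \<Rightarrow> ('a \<Rightarrow> 'a \<Rightarrow> 'a) \<Rightarrow> ('a \<Rightarrow> 'a) set" where
  "quandle_auts X op = {f \<in> Bij X. \<forall>x\<in>X. \<forall>y\<in>X. f (op x y) = op (f x) (f y)}"

definition quandle_AutGroup :: "'a set \<Rightarrow> ('a \<Rightarrow> 'a \<Rightarrow> 'a) \<Rightarrow> ('a \<Rightarrow> 'a) monoid" where
  "quandle_AutGroup X op = (BijGroup X) \<lparr>carrier := quandle_auts X op\<rparr>"

definition quandle_Inn :: "'a set \<Rightarrow> ('a \<Rightarrow> 'a \<Rightarrow> 'a) \<Rightarrow> ('a \<Rightarrow> 'a) monoid" where
  "quandle_Inn X op = (quandle_AutGroup X op)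
     \<lparr>carrier := generate (quandle_AutGroup X op) (right_mult X op ` X)\<rparr>"

definition quandle_orbits :: "'a set \<Rightarrow> ('a \<Rightarrow> 'a \<Rightarrow> 'a) \<Rightarrow> 'a set set" where
  "quandle_orbits X op = orbits (quandle_Inn X op) X (\<lambda>f. f)"

lemma subgroup_quandle_auts:
  assumes "\<And>x y. \<lbrakk>x \<in> X; y \<in> X\<rbrakk> \<Longrightarrow> op x y \<in> X"
  shows "subgroup (quandle_auts X op) (BijGroup X)"
proof (rule group.subgroupI)
  show "group (BijGroup X)" by (rule group_BijGroup)
  show "quandle_auts X op \<subseteq> carrier (BijGroup X)"
    by (auto simp: quandle_auts_def BijGroup_def)
  have "(\<lambda>x\<in>X. x) \<in> quandle_auts X op"
    using assms id_Bij by (auto simp: quandle_auts_def)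
  then show "quandle_auts X op \<noteq> {}" by blast
next
  fix f assume f: "f \<in> quandle_auts X op"
  then have fB: "f \<in> Bij X" by (simp add: quandle_auts_def)
  let ?g = "\<lambda>x\<in>X. inv_into X f x"
  have inX: "inv_into X f x \<in> X" if "x \<in> X" for x
    using Bij_inv_into_mem[OF fB that] .
  have bij: "bij_betw f X X" using fB by (simp add: Bij_def)
  have "inv_into X f (op x y) = op (inv_into X f x) (inv_into X f y)"
    if xy: "x \<in> X" "y \<in> X" for x y
  proof -
    have "f (op (inv_into X f x) (inv_into X f y)) = op x y"
      using f inX xy bij_betw_inv_into_right[OF bij] by (simp add: quandle_auts_def)
    then show ?thesis
      using bij_betw_inv_into_left[OF bij] assms[OF inX[OF xy(1)] inX[OF xy(2)]] by metis
  qed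
  then have "?g \<in> quandle_auts X op"
    using assms restrict_inv_into_Bij[OF fB] by (simp add: quandle_auts_def)
  then show "inv\<^bsub>BijGroup X\<^esub> f \<in> quandle_auts X op"
    using inv_BijGroup[OF fB] by simp
next
  fix f g assume fg: "f \<in> quandle_auts X op" "g \<in> quandle_auts X op"
  then have B: "f \<in> Bij X" "g \<in> Bij X" by (simp_all add: quandle_auts_def)
  have "g x \<in> X" if "x \<in> X" for x using Bij_imp_funcset[OF B(2)] that by auto
  then show "f \<otimes>\<^bsub>BijGroup X\<^esub> g \<in> quandle_auts X op"
    using fg B assms compose_Bij[OF B]
    by (simp add: BijGroup_def quandle_auts_def compose_def)
qed

context quandle
begin

lemma group_quandle_AutGroup: "group (quandle_AutGroup X op)"
  unfolding quandle_AutGroup_def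
  by (intro group.subgroup_imp_group group_BijGroup subgroup_quandle_auts closed)

lemma right_mult_in_auts:
  assumes y: "y \<in> X"
  shows "right_mult X op y \<in> quandle_auts X op"
proof -
  have "bij_betw (right_mult X op y) X X"
    unfolding bij_betw_def
  proof
    show "inj_on (right_mult X op y) X"
    proof (rule inj_onI)
      fix a b assume ab: "a \<in> X" "b \<in> X" "right_mult X op y a = right_mult X op y b"
      then have "a \<triangleright> y = b \<triangleright> y" by (simp add: right_mult_def)
      with ab(1,2) right_div[OF y closed[OF ab(2) y]] show "a = b" by blast
    qed
    show "right_mult X op y ` X = X"
    proof
      show "right_mult X op y ` X \<subseteq> X"
        using closed y by (auto simp: right_mult_def)
      show "X \<subseteq> right_mult X op y ` X"
      proof
        fix z assume "z \<in> X"
        then obtain x where "x \<in> X" "x \<triangleright> y = z" using right_div[OF y] by blast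
        then show "z \<in> right_mult X op y ` X" by (auto simp: right_mult_def image_iff)
      qed
    qed
  qed
  then have "right_mult X op y \<in> Bij X"
    by (simp add: Bij_def right_mult_def)
  then show ?thesis
    using y by (simp add: quandle_auts_def right_mult_def closed self_distrib[symmetric])
qed

lemma subgroup_quandle_Inn:
  "subgroup (carrier (quandle_Inn X op)) (quandle_AutGroup X op)"
proof -
  have "right_mult X op ` X \<subseteq> carrier (quandle_AutGroup X op)"
    using right_mult_in_auts by (auto simp: quandle_AutGroup_def)
  then show ?thesis
    using group.generate_is_subgroup[OF group_quandle_AutGroup]
    by (simp add: quandle_Inn_def)
qed

lemma group_quandle_Inn: "group (quandle_Inn X op)"
  using group.subgroup_imp_group[OF group_quandle_AutGroup subgroup_quandle_Inn]
  by (simp add: quandle_Inn_def)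

lemma group_action_quandle_Inn: "group_action (quandle_Inn X op) X (\<lambda>f. f)"
proof -
  have "carrier (quandle_Inn X op) \<subseteq> carrier (BijGroup X)"
    using subgroup.subset[OF subgroup_quandle_Inn]
    by (auto simp: quandle_AutGroup_def quandle_auts_def BijGroup_def)
  then have "(\<lambda>f. f) \<in> hom (quandle_Inn X op) (BijGroup X)"
    by (auto simp: hom_def quandle_Inn_def quandle_AutGroup_def)
  then show ?thesis
    using group_quandle_Inn group_BijGroup
    by (simp add: group_action_def group_hom_def group_hom_axioms_def)
qed

end

end

theory Submission
  imports Defs
begin

text \<open>A finite \<open>T\<^sub>0\<close> topology is determined by the minimal open neighbourhoods \<open>U\<^sub>x\<close> of its points.
  A continuous bijection of a finite space cannot decrease \<open>card U\<^sub>x\<close>, and since it permutes the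
  points it preserves these numbers. With a single orbit they are all equal; as
  \<open>z \<in> U\<^sub>x\<close> implies \<open>U\<^sub>z \<subseteq> U\<^sub>x\<close>, this forces \<open>U\<^sub>z = U\<^sub>x\<close>, hence \<open>z = x\<close>, and the space is discrete.
  Conversely, if \<open>A\<close> is one of several orbits, the order putting every point of \<open>A\<close> below every point
  of \<open>X - A\<close>, with no other relations, is invariant, and its up-sets are the required topology.\<close>

section \<open>Minimal open neighbourhoods in a finite space\<close>

definition min_nbhd :: "'a topology \<Rightarrow> 'a \<Rightarrow> 'a set" where
  "min_nbhd T x = \<Inter> {U. openin T U \<and> x \<in> U}"

text \<open>For \<open>x\<close> outside \<open>topspace T\<close> no open set contains
  \<open>x\<close>, and the empty intersection is \<open>UNIV\<close>.\<close>

lemma in_min_nbhd: "x \<in> min_nbhd T x"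
  by (auto simp: min_nbhd_def)

lemma min_nbhd_subset: "openin T U \<Longrightarrow> x \<in> U \<Longrightarrow> min_nbhd T x \<subseteq> U"
  by (auto simp: min_nbhd_def)

lemma openin_min_nbhd:
  assumes "finite (topspace T)" and "x \<in> topspace T"
  shows "openin T (min_nbhd T x)"
  unfolding min_nbhd_def
proof (rule openin_Inter)
  have "{U. openin T U \<and> x \<in> U} \<subseteq> Pow (topspace T)"
    using openin_subset by blast
  then show "finite {U. openin T U \<and> x \<in> U}"
    using assms(1) finite_subset by blast
  show "{U. openin T U \<and> x \<in> U} \<noteq> {}"
    using openin_topspace assms(2) by blast
qed blast

text \<open>An open set containing just one of two points contains the minimal neighbourhood of that
  point; if both points shared it, the other point would lie in the set too.\<close>

lemma min_nbhd_inj: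
  assumes "t0_space T" and "x \<in> topspace T" and "y \<in> topspace T"
    and "min_nbhd T x = min_nbhd T y"
  shows "x = y"
proof (rule ccontr)
  assume "x \<noteq> y"
  then obtain U where U: "openin T U" "(x \<notin> U) = (y \<in> U)"
    using assms(1-3) unfolding t0_space_def by blast
  have "x \<in> min_nbhd T y" "y \<in> min_nbhd T x"
    using in_min_nbhd[of x T] in_min_nbhd[of y T] assms(4) by simp_all
  with U show False using min_nbhd_subset[OF U(1)] by blast
qed

text \<open>Continuity is given for \<open>f\<close> but not for its inverse, so it yields only an
  inequality; counting over the whole space turns this into equality.\<close>

lemma card_min_nbhd_bij:
  assumes fin: "finite (topspace T)" and cont: "continuous_map T T f"
    and bij: "bij_betw f (topspace T) (topspace T)" and x: "x \<in> topspace T"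
  shows "card (min_nbhd T (f x)) = card (min_nbhd T x)"
proof -
  let ?X = "topspace T" and ?c = "\<lambda>x. card (min_nbhd T x)"
  have le: "?c a \<le> ?c (f a)" if a: "a \<in> ?X" for a
  proof (rule card_inj_on_le)
    have fa: "f a \<in> ?X" using bij a by (rule bij_betwE[rule_format])
    have "openin T {z \<in> ?X. f z \<in> min_nbhd T (f a)}"
      using openin_continuous_map_preimage[OF cont openin_min_nbhd[OF fin fa]] .
    then have sub: "min_nbhd T a \<subseteq> {z \<in> ?X. f z \<in> min_nbhd T (f a)}"
      by (rule min_nbhd_subset) (simp add: a in_min_nbhd)
    then show "f ` min_nbhd T a \<subseteq> min_nbhd T (f a)" by blast
    show "inj_on f (min_nbhd T a)"
      using inj_on_subset[OF bij_betw_imp_inj_on[OF bij]] sub by blast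
    show "finite (min_nbhd T (f a))"
      using fin openin_subset[OF openin_min_nbhd[OF fin fa]] finite_subset by blast
  qed
  \<comment> \<open>As \<open>f\<close> permutes the points, both sides of the pointwise inequality
    \<open>le\<close> have the same sum over a finite set, so no single inequality can be
    strict.\<close>
  have "sum ?c ?X = (\<Sum>a\<in>?X. ?c (f a))"
    using sum.reindex_bij_betw[OF bij, of ?c] by simp
  then show ?thesis
    using sum_mono_inv[of ?c ?X "\<lambda>a. ?c (f a)" x] le x fin by metis
qed

lemma discrete_if_card_min_nbhd_const:
  assumes fin: "finite (topspace T)" and t0: "t0_space T"
    and const: "\<And>x y. x \<in> topspace T \<Longrightarrow> y \<in> topspace T \<Longrightarrow>
      card (min_nbhd T x) = card (min_nbhd T y)"
  shows "T = discrete_topology (topspace T)"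
proof -
  have "openin T {x}" if x: "x \<in> topspace T" for x
  proof -
    have op: "openin T (min_nbhd T x)" by (rule openin_min_nbhd[OF fin x])
    have "z = x" if z: "z \<in> min_nbhd T x" for z
    proof -
      have zX: "z \<in> topspace T" using openin_subset[OF op] z by blast
      have "min_nbhd T z = min_nbhd T x"
        by (rule card_subset_eq[OF finite_subset[OF openin_subset[OF op] fin]
              min_nbhd_subset[OF op z] const[OF zX x]])
      then show ?thesis using min_nbhd_inj[OF t0 zX x] by simp
    qed
    then have "min_nbhd T x = {x}" using in_min_nbhd[of x T] by blast
    with op show ?thesis by simp
  qed
  then show ?thesis
    by (intro sym[OF iffD2[OF discrete_topology_unique]]) blast
qed

section \<open>The two-level topology\<close>

text \<open>This is the Alexandrov topology of the order with \<open>X \<inter> A\<close> as lower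
  and \<open>X - A\<close> as upper level.\<close>

definition split_topology :: "'a set \<Rightarrow> 'a set \<Rightarrow> 'a topology" where
  "split_topology X A = topology (\<lambda>U. U \<subseteq> X \<and> (U \<inter> A \<noteq> {} \<longrightarrow> X - A \<subseteq> U))"

lemma openin_split_topology:
  "openin (split_topology X A) U \<longleftrightarrow> U \<subseteq> X \<and> (U \<inter> A \<noteq> {} \<longrightarrow> X - A \<subseteq> U)"
proof -
  have "istopology (\<lambda>U. U \<subseteq> X \<and> (U \<inter> A \<noteq> {} \<longrightarrow> X - A \<subseteq> U))"
    unfolding istopology_def by blast
  then show ?thesis by (simp add: split_topology_def topology_inverse')
qed

lemma topspace_split_topology: "topspace (split_topology X A) = X"
  unfolding topspace_def openin_split_topology by blast

lemma t0_space_split_topology: "t0_space (split_topology X A)"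
  unfolding t0_space_def topspace_split_topology
proof (intro ballI impI)
  fix x y assume xy: "x \<in> X" "y \<in> X" "x \<noteq> y"
  show "\<exists>U. openin (split_topology X A) U \<and> (x \<notin> U) = (y \<in> U)"
  \<comment> \<open>Points of the upper level have open singletons. For two points of
    \<open>A\<close>, the minimal neighbourhood of \<open>x\<close>, namely
    \<open>insert x (X - A)\<close>, misses \<open>y\<close>.\<close>
  proof (cases "x \<in> A")
    case True
    show ?thesis
    proof (cases "y \<in> A")
      case True
      with xy \<open>x \<in> A\<close> show ?thesis
        by (intro exI[of _ "insert x (X - A)"]) (auto simp: openin_split_topology)
    next
      case False
      with xy show ?thesis by (intro exI[of _ "{y}"]) (auto simp: openin_split_topology)
    qed
  next
    case False
    with xy show ?thesis by (intro exI[of _ "{x}"]) (auto simp: openin_split_topology)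
  qed
qed

lemma split_topology_not_discrete:
  assumes "x \<in> X \<inter> A" and "y \<in> X - A"
  shows "split_topology X A \<noteq> discrete_topology X"
proof
  assume "split_topology X A = discrete_topology X"
  then have "openin (split_topology X A) {x}" using assms(1) by simp
  with assms show False by (auto simp: openin_split_topology)
qed

text \<open>If the preimage of an open \<open>U\<close> meets \<open>A\<close>, then so does
  \<open>U\<close>, because \<open>f\<close> preserves \<open>A\<close>. Hence \<open>U\<close>
  contains \<open>X - A\<close>, and \<open>f\<close> sends \<open>X - A\<close> into
  itself.\<close>

lemma continuous_map_split_topology:
  assumes "f \<in> X \<rightarrow> X" and "\<And>x. x \<in> X \<Longrightarrow> f x \<in> A \<longleftrightarrow> x \<in> A"
  shows "continuous_map (split_topology X A) (split_topology X A) f"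
  unfolding continuous_map_def topspace_split_topology openin_split_topology
  using assms by fast

section \<open>Inner automorphisms and orbits\<close>

context quandle
begin

text \<open>Induction over the generated group passes invariance from the right multiplications to
  inverses and products. The function \<open>c\<close> will be the size of the minimal
  neighbourhood.\<close>

lemma Inn_invariant:
  assumes inv: "\<And>x y. \<lbrakk>x \<in> X; y \<in> X\<rbrakk> \<Longrightarrow> c (x \<triangleright> y) = c x"
    and g: "g \<in> carrier (quandle_Inn X op)" and x: "x \<in> X"
  shows "c (g x) = c x"
proof -
  let ?G = "quandle_AutGroup X op"
  \<comment> \<open>The product of \<open>BijGroup X\<close> is specified only on
    \<open>Bij X\<close>, so membership there is required to evaluate it as a composition.\<close>
  have sub: "generate ?G (right_mult X op ` X) \<subseteq> Bij X"
  proof -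
    have "generate ?G (right_mult X op ` X) \<subseteq> carrier ?G"
      using subgroup.subset[OF subgroup_quandle_Inn] by (simp add: quandle_Inn_def)
    also have "carrier ?G \<subseteq> Bij X"
      by (auto simp: quandle_AutGroup_def quandle_auts_def)
    finally show ?thesis .
  qed
  have "g \<in> generate ?G (right_mult X op ` X)"
    using g by (simp add: quandle_Inn_def)
  then show ?thesis using x
  proof (induction arbitrary: x)
    case one
    then show ?case by (simp add: quandle_AutGroup_def BijGroup_def)
  next
    case (incl h)
    then obtain y where "y \<in> X" "h = right_mult X op y" by blast
    then show ?case using assms(1)[OF incl.prems] incl.prems by (simp add: right_mult_def)
  next
    case (inv h)
    then obtain y where y: "y \<in> X" "h = right_mult X op y" by blast
    then have h: "h \<in> quandle_auts X op" using right_mult_in_auts by simp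
    then have hB: "h \<in> Bij X" by (simp add: quandle_auts_def)
    have "inv\<^bsub>?G\<^esub> h = inv\<^bsub>BijGroup X\<^esub> h"
      unfolding quandle_AutGroup_def
      by (rule group.m_inv_consistent[OF group_BijGroup subgroup_quandle_auts[OF closed] h])
    then have e: "(inv\<^bsub>?G\<^esub> h) x = inv_into X h x"
      using inv.prems by (simp add: inv_BijGroup[OF hB])
    \<comment> \<open>Writing \<open>x\<close> as \<open>z \<triangleright> y\<close> with
      \<open>z = inv_into X h x\<close>, invariance under right multiplication gives
      \<open>c x = c z\<close>.\<close>
    have z: "inv_into X h x \<in> X" by (rule Bij_inv_into_mem[OF hB inv.prems])
    have "h (inv_into X h x) = x"
      using hB inv.prems bij_betw_inv_into_right[of h X X x] by (simp add: Bij_def)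
    moreover have "h (inv_into X h x) = inv_into X h x \<triangleright> y"
      using z by (simp add: y(2) right_mult_def)
    ultimately show ?case
      using assms(1)[OF z y(1)] e by metis
  next
    case (eng h1 h2)
    then have B: "h1 \<in> Bij X" "h2 \<in> Bij X" using sub by auto
    have h2x: "h2 x \<in> X"
      using funcset_mem[OF Bij_imp_funcset[OF B(2)] eng.prems] .
    have "(h1 \<otimes>\<^bsub>?G\<^esub> h2) x = h1 (h2 x)"
      using B eng.prems by (simp add: quandle_AutGroup_def BijGroup_def compose_eq)
    then show ?case
      using eng.IH(1)[OF h2x] eng.IH(2)[OF eng.prems] by simp
  qed
qed

lemma right_mult_in_Inn: "y \<in> X \<Longrightarrow> right_mult X op y \<in> carrier (quandle_Inn X op)"
  unfolding quandle_Inn_def by (simp add: generate.incl)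

text \<open>The points \<open>x\<close> and \<open>x \<triangleright> y\<close> share an orbit,
  since right multiplications are themselves inner automorphisms.\<close>

lemma orbit_mult_iff:
  assumes x: "x \<in> X" and y: "y \<in> X" and A: "A \<in> quandle_orbits X op"
  shows "x \<triangleright> y \<in> A \<longleftrightarrow> x \<in> A"
proof -
  interpret group_action "quandle_Inn X op" X "\<lambda>f. f" by (rule group_action_quandle_Inn)
  let ?o = "orbit (quandle_Inn X op) (\<lambda>f. f)"
  obtain a where a: "a \<in> X" "A = ?o a"
    using A by (auto simp: quandle_orbits_def orbits_def)
  have "right_mult X op y x \<in> ?o x"
    using right_mult_in_Inn[OF y] unfolding orbit_def by blast
  then have xy: "x \<triangleright> y \<in> ?o x"
    using x by (simp add: right_mult_def)
  have yx: "x \<in> ?o (x \<triangleright> y)"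
    using orbit_sym[OF x closed[OF x y] xy] .
  show ?thesis
    unfolding a(2)
  proof
    show "x \<in> ?o a" if "x \<triangleright> y \<in> ?o a"
      by (rule orbit_trans[OF a(1) closed[OF x y] x that yx])
    show "x \<triangleright> y \<in> ?o a" if "x \<in> ?o a"
      by (rule orbit_trans[OF a(1) x closed[OF x y] that xy])
  qed
qed

lemma invariant_const_if_one_orbit:
  assumes inv: "\<And>x y. \<lbrakk>x \<in> X; y \<in> X\<rbrakk> \<Longrightarrow> c (x \<triangleright> y) = c x"
    and fin: "finite X" and one: "card (quandle_orbits X op) \<le> 1"
    and x: "x \<in> X" and y: "y \<in> X"
  shows "c x = c y"
proof -
  interpret group_action "quandle_Inn X op" X "\<lambda>f. f" by (rule group_action_quandle_Inn)
  let ?o = "orbit (quandle_Inn X op) (\<lambda>f. f)"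
  have orbs: "quandle_orbits X op = ?o ` X"
    by (auto simp: quandle_orbits_def orbits_def)
  \<comment> \<open>Finiteness excludes an infinite set of orbits, whose \<open>card\<close> would
    be 0.\<close>
  then have "finite (quandle_orbits X op)" and mem: "?o x \<in> quandle_orbits X op"
      "?o y \<in> quandle_orbits X op"
    using fin x y by simp_all
  then have "\<forall>A\<in>quandle_orbits X op. \<forall>B\<in>quandle_orbits X op. A = B"
    using one card_le_Suc0_iff_eq by (metis One_nat_def)
  then have "?o x = ?o y" using mem by blast
  then have "y \<in> ?o x" using orbit_refl[OF y] by simp
  then obtain g where g: "g \<in> carrier (quandle_Inn X op)" "y = g x"
    by (auto simp: orbit_def)
  have "c (g x) = c x"
    using inv g(1) x by (rule Inn_invariant)
  then show ?thesis using g(2) by simp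
qed

lemma obtain_proper_orbit:
  assumes "card (quandle_orbits X op) > 1"
  obtains A a b where "A \<in> quandle_orbits X op" "a \<in> X \<inter> A" "b \<in> X - A"
proof -
  interpret group_action "quandle_Inn X op" X "\<lambda>f. f" by (rule group_action_quandle_Inn)
  let ?o = "orbit (quandle_Inn X op) (\<lambda>f. f)"
  have orbs: "quandle_orbits X op = ?o ` X"
    by (auto simp: quandle_orbits_def orbits_def)
  obtain A B where AB: "A \<in> quandle_orbits X op" "B \<in> quandle_orbits X op" "A \<noteq> B"
  proof -
    \<comment> \<open>A positive \<open>card\<close> forces finiteness, as infinite sets have
      \<open>card\<close> 0.\<close>
    have "finite (quandle_orbits X op)"
      using assms by (intro card_ge_0_finite) simp
    moreover have "\<not> card (quandle_orbits X op) \<le> Suc 0" using assms by simp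
    ultimately show thesis
      using that card_le_Suc0_iff_eq[of "quandle_orbits X op"] by blast
  qed
  obtain a b where ab: "a \<in> X" "A = ?o a" "b \<in> X" "B = ?o b"
    using AB orbs by auto
  have "a \<in> A" "b \<in> B" using ab orbit_refl by auto
  \<comment> \<open>Distinct orbits are disjoint, so \<open>b\<close> from \<open>B\<close> is a
    point outside \<open>A\<close>.\<close>
  moreover have "A \<inter> B = {}"
    using disjoint_union[of A B] AB by (simp add: quandle_orbits_def)
  ultimately show thesis using that[of A a b] AB ab by blast
qed

end

theorem mainTheorem8:
  fixes X :: "'a set" and op :: "'a \<Rightarrow> 'a \<Rightarrow> 'a"
  assumes "quandle X op" and "finite X"
  shows "(\<exists>T :: 'a topology. topspace T = X \<and> T \<noteq> discrete_topology X \<and> t0_space T \<and>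
            (\<forall>y\<in>X. continuous_map T T (right_mult X op y)))
         \<longleftrightarrow> card (quandle_orbits X op) > 1"
proof -
  interpret quandle X op by fact
  show ?thesis
  proof
    assume "\<exists>T :: 'a topology. topspace T = X \<and> T \<noteq> discrete_topology X \<and> t0_space T \<and>
            (\<forall>y\<in>X. continuous_map T T (right_mult X op y))"
    then obtain T :: "'a topology" where T: "topspace T = X" "T \<noteq> discrete_topology X"
      "t0_space T" "\<And>y. y \<in> X \<Longrightarrow> continuous_map T T (right_mult X op y)" by blast
    have inv: "card (min_nbhd T (op x y)) = card (min_nbhd T x)" if "x \<in> X" "y \<in> X" for x y
    proof -
      have "bij_betw (right_mult X op y) X X"
        using right_mult_in_auts[OF that(2)] by (simp add: quandle_auts_def Bij_def)
      then show ?thesis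
        using card_min_nbhd_bij[of T "right_mult X op y" x] T(1,4) that assms(2)
        by (simp add: right_mult_def)
    qed
    show "card (quandle_orbits X op) > 1"
    proof (rule ccontr)
      assume "\<not> card (quandle_orbits X op) > 1"
      \<comment> \<open>The negation also covers empty \<open>X\<close> with no orbits, where
        \<open>const\<close> is vacuous.\<close>
      then have const: "card (min_nbhd T x) = card (min_nbhd T y)" if "x \<in> X" "y \<in> X" for x y
        using invariant_const_if_one_orbit[of "\<lambda>x. card (min_nbhd T x)" x y]
          inv assms(2) that by simp
      have "T = discrete_topology (topspace T)"
      proof (rule discrete_if_card_min_nbhd_const)
        show "finite (topspace T)" using T(1) assms(2) by simp
        show "t0_space T" by (rule T(3))
        show "card (min_nbhd T x) = card (min_nbhd T y)"
          if "x \<in> topspace T" "y \<in> topspace T" for x y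
          using that unfolding T(1) by (rule const)
      qed
      then have "T = discrete_topology X" unfolding T(1) .
      with T(2) show False ..
    qed
  next
    assume "card (quandle_orbits X op) > 1"
    then obtain A a b where A: "A \<in> quandle_orbits X op" "a \<in> X \<inter> A" "b \<in> X - A"
      by (rule obtain_proper_orbit)
    \<comment> \<open>Any orbit with nonempty complement serves as lower level, since right
      multiplications preserve membership in it.\<close>
    have "continuous_map (split_topology X A) (split_topology X A) (right_mult X op y)"
      if y: "y \<in> X" for y
    proof (rule continuous_map_split_topology)
      show "right_mult X op y \<in> X \<rightarrow> X"
        using closed y by (simp add: right_mult_def)
      show "right_mult X op y x \<in> A \<longleftrightarrow> x \<in> A" if x: "x \<in> X" for x
        using orbit_mult_iff[OF x y A(1)] x by (simp add: right_mult_def)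
    qed
    then show "\<exists>T :: 'a topology. topspace T = X \<and> T \<noteq> discrete_topology X \<and> t0_space T \<and>
            (\<forall>y\<in>X. continuous_map T T (right_mult X op y))"
      using topspace_split_topology[of X A] split_topology_not_discrete[OF A(2,3)]
        t0_space_split_topology[of X A] by (intro exI[of _ "split_topology X A"]) simp
  qed
qed

end
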